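(* Let $\lambda\in\sigma_{ell}(J_T)$ with $C(\lambda;T)\neq0$. Let $\omega_n(\lambda)$ and $\varphi_n(\lambda)$ be as defined in the context, let $\alpha>\frac32$, write $n=T(k-1)+s$ with $s\in\{0,\dots,T-1\}$, and let $$q_n=-a_{n-1}\left(\mathrm{Im}(\varphi_{n-1}(\lambda))\right)^2\left(\frac{n^{-\alpha}}{\omega_n(\lambda)}\right)+a_n\left(\mathrm{Im}(\varphi_{n+1}(\lambda))\right)^2\left(\frac{(n+1)^{-\alpha}}{\omega_n(\lambda)}\right).$$ Then $u_n(\lambda)=\omega_n(\lambda)\,\mathrm{Im}(\varphi_n(\lambda))$ satisfies $$a_{n-1}u_{n-1}+a_nu_{n+1}+(q_n-\lambda)u_n=0\qquad\text{for } n\ge2 .$$ Moreover, $q_n$ has the asymptotic behaviour $$q_n=\frac1n\left(\rho_s(\lambda)\sin\left(2n\theta(\lambda)/T+\zeta_s(\lambda)\right)+\delta_s(\lambda)\right)+O\left(\frac{1}{n^2}\right),\qquad n\to\infty,$$ where $\rho_s,\zeta_s$ and $\delta_s$ are real functions.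
   Context: Let $T\ge1$, $a_1,\dots,a_T>0$, extended periodically by $a_{n+T}=a_n$, so in particular $a_0=a_T$. $J_T$ is the $T$-periodic Jacobi operator on $l^2(\mathbb{N};\mathbb{C})$ with zero diagonal and off-diagonal entries $a_1,a_2,\dots$. For $\lambda\in\mathbb{C}$ and $j\in\{1,\dots,T\}$ put $$B_j(\lambda)=\begin{pmatrix}0&1\\ -\frac{a_{j-1}}{a_j}&\frac{\lambda}{a_j}\end{pmatrix},\qquad M(\lambda)=B_T(\lambda)B_{T-1}(\lambda)\cdots B_1(\lambda)=\begin{pmatrix}m_{11}(\lambda)&m_{12}(\lambda)\\ m_{21}(\lambda)&m_{22}(\lambda)\end{pmatrix}.$$ $\sigma_{ell}(J_T)$ is the set of elliptic points, i.e. of those $\lambda\in\mathbb{C}$ for which $M(\lambda)$ has two distinct eigenvalues of modulus one; equivalently, the set of real $\lambda$ with $|\mathrm{Tr}\,M(\lambda)|<2$. For $\lambda\in\sigma_{ell}(J_T)$ the eigenvalues of $M(\lambda)$ are $\mu(\lambda)=e^{i\theta(\lambda)}$ and $e^{-i\theta(\lambda)}$ with $\theta(\lambda)$ real (the quasi-momentum), and $m_{12}(\lambda)\ne0$. Define $(\varphi_n(\lambda))_{n\ge0}$ by $\varphi_0=1$, $\varphi_1=(\mu-m_{11})/m_{12}$ and $a_{n-1}\varphi_{n-1}+a_n\varphi_{n+1}=\lambda\varphi_n$ for $n\ge1$; it satisfies $\varphi_{T(k-1)+s}=\varphi_s e^{i(k-1)\theta(\lambda)}$ for $s\in\{0,\dots,T-1\}$,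 $k\ge1$. Further, $$C(\lambda;T)=\mathrm{Re}\left(\sum_{s=1}^{T}\varphi_s(\lambda)\overline{\varphi_{s-1}(\lambda)}\right),\qquad \omega_n(\lambda)=\sum_{m=n+1}^{\infty}m^{-\alpha}\,\mathrm{Im}(\varphi_m(\lambda))\,\mathrm{Im}(\varphi_{m-1}(\lambda)).$$ Convention on zeros of $\omega_n$ (no restriction on $\lambda$ or $\alpha$): since $C(\lambda;T)\ne0$, there is $L$ with $\omega_n\ne0$ for all $n\ge L$. If $\omega_n$ vanishes for some $n<L$, the definition of $\omega_n$ is changed by inserting a factor $c_m$ into the $m$-th term of the sum, where $c_m=1$ for all $m\ge L$ and $c_1,\dots,c_{L-1}$ are real numbers chosen so that $\omega_n\neq0$ for all $n\ge1$ (such a choice is possible, increasing $L$ if necessary); in the formula for $q_n$ the factors $n^{-\alpha}$ and $(n+1)^{-\alpha}$ are then replaced by $c_nn^{-\alpha}$ and $c_{n+1}(n+1)^{-\alpha}$. *)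

theory Defs
  imports
    Complex_Main
    "HOL-Library.Landau_Symbols"
    "Jordan_Normal_Form.Char_Poly"
begin

(* The spectral parameter is written z throughout. *)

definition one_step_matrix :: "(nat \<Rightarrow> real) \<Rightarrow> complex \<Rightarrow> nat \<Rightarrow> complex mat" where
  "one_step_matrix a z j = mat_of_rows_list 2
     [[0, 1],
      [- of_real (a (j - 1) / a j), z / of_real (a j)]]"

(* The product B_j * B_(j-1) * ... * B_1. *)
primrec transfer_product :: "(nat \<Rightarrow> real) \<Rightarrow> complex \<Rightarrow> nat \<Rightarrow> complex mat" where
  "transfer_product a z 0 = 1\<^sub>m 2"
| "transfer_product a z (Suc j) = one_step_matrix a z (Suc j) * transfer_product a z j"

definition monodromy :: "(nat \<Rightarrow> real) \<Rightarrow> nat \<Rightarrow> complex \<Rightarrow> complex mat" where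
  "monodromy a T z = transfer_product a z T"

definition elliptic_points :: "(nat \<Rightarrow> real) \<Rightarrow> nat \<Rightarrow> complex set" where
  "elliptic_points a T = {z. \<exists>\<mu>\<^sub>1 \<mu>\<^sub>2. \<mu>\<^sub>1 \<noteq> \<mu>\<^sub>2 \<and> cmod \<mu>\<^sub>1 = 1 \<and> cmod \<mu>\<^sub>2 = 1 \<and>
     eigenvalue (monodromy a T z) \<mu>\<^sub>1 \<and> eigenvalue (monodromy a T z) \<mu>\<^sub>2}"

(* A quasi-momentum is determined only up to sign and integer multiples of 2 pi, separately
   at each point; any real-valued choice on the set of elliptic points is allowed. *)
definition quasi_momentum :: "(nat \<Rightarrow> real) \<Rightarrow> nat \<Rightarrow> (complex \<Rightarrow> real) \<Rightarrow> bool" where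
  "quasi_momentum a T \<theta> \<longleftrightarrow> (\<forall>z\<in>elliptic_points a T.
     {\<mu>. eigenvalue (monodromy a T z) \<mu>} = {exp (\<i> * of_real (\<theta> z)), exp (- \<i> * of_real (\<theta> z))})"

(* Matrix indices start at 0, so the entries $$ (0,0) and $$ (0,1) are m_11 and m_12.
   The last equation is a_n phi_n + a_(n+1) phi_(n+2) = z phi_(n+1) solved for phi_(n+2). *)
fun bloch :: "(nat \<Rightarrow> real) \<Rightarrow> nat \<Rightarrow> (complex \<Rightarrow> real) \<Rightarrow> complex \<Rightarrow> nat \<Rightarrow> complex" where
  "bloch a T \<theta> z 0 = 1"
| "bloch a T \<theta> z (Suc 0) =
     (exp (\<i> * of_real (\<theta> z)) - monodromy a T z $$ (0,0)) / monodromy a T z $$ (0,1)"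
| "bloch a T \<theta> z (Suc (Suc n)) =
     (z * bloch a T \<theta> z (Suc n) - of_real (a n) * bloch a T \<theta> z n) / of_real (a (Suc n))"

definition C_const :: "(nat \<Rightarrow> real) \<Rightarrow> nat \<Rightarrow> (complex \<Rightarrow> real) \<Rightarrow> complex \<Rightarrow> real" where
  "C_const a T \<theta> z = Re (\<Sum>s=1..T. bloch a T \<theta> z s * cnj (bloch a T \<theta> z (s - 1)))"

(* The factors c m are those of the convention on zeros; c = (\<lambda>_. 1) is the unmodified sum.
   The series over m > n is indexed by i with m = n + 1 + i. *)
definition omega :: "(nat \<Rightarrow> real) \<Rightarrow> nat \<Rightarrow> (complex \<Rightarrow> real) \<Rightarrow> real \<Rightarrow> (nat \<Rightarrow> real) \<Rightarrow>
    complex \<Rightarrow> nat \<Rightarrow> real" where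
  "omega a T \<theta> \<alpha> c z n = (\<Sum>i. c (n + 1 + i) * real (n + 1 + i) powr (- \<alpha>) *
     Im (bloch a T \<theta> z (n + 1 + i)) * Im (bloch a T \<theta> z (n + i)))"

(* The convention on zeros: no factors are inserted if the unmodified omega_n has no zero with
   n \<ge> 1; otherwise finitely many real factors are inserted so as to remove all such zeros.
   The value c 0 is never used. *)
definition admissible_factors :: "(nat \<Rightarrow> real) \<Rightarrow> nat \<Rightarrow> (complex \<Rightarrow> real) \<Rightarrow> real \<Rightarrow> complex \<Rightarrow>
    (nat \<Rightarrow> real) \<Rightarrow> bool" where
  "admissible_factors a T \<theta> \<alpha> z c \<longleftrightarrow>
     (if \<forall>n\<ge>1. omega a T \<theta> \<alpha> (\<lambda>_. 1) z n \<noteq> 0 then c = (\<lambda>_. 1)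
      else \<exists>L. (\<forall>n\<ge>L. omega a T \<theta> \<alpha> (\<lambda>_. 1) z n \<noteq> 0) \<and> (\<forall>m\<ge>L. c m = 1) \<and>
               (\<forall>n\<ge>1. omega a T \<theta> \<alpha> c z n \<noteq> 0))"

definition u_seq :: "(nat \<Rightarrow> real) \<Rightarrow> nat \<Rightarrow> (complex \<Rightarrow> real) \<Rightarrow> real \<Rightarrow> (nat \<Rightarrow> real) \<Rightarrow>
    complex \<Rightarrow> nat \<Rightarrow> real" where
  "u_seq a T \<theta> \<alpha> c z n = omega a T \<theta> \<alpha> c z n * Im (bloch a T \<theta> z n)"

definition q_seq :: "(nat \<Rightarrow> real) \<Rightarrow> nat \<Rightarrow> (complex \<Rightarrow> real) \<Rightarrow> real \<Rightarrow> (nat \<Rightarrow> real) \<Rightarrow>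
    complex \<Rightarrow> nat \<Rightarrow> real" where
  "q_seq a T \<theta> \<alpha> c z n =
     - a (n - 1) * (Im (bloch a T \<theta> z (n - 1)))\<^sup>2 *
         (c n * real n powr (- \<alpha>) / omega a T \<theta> \<alpha> c z n)
     + a n * (Im (bloch a T \<theta> z (n + 1)))\<^sup>2 *
         (c (n + 1) * real (n + 1) powr (- \<alpha>) / omega a T \<theta> \<alpha> c z n)"

end

theory Submission
  imports Defs "HOL-Analysis.Summation_Tests" "HOL-Real_Asymp.Real_Asymp"
begin

text \<open>The recurrence is exact, since consecutive values of \<open>\<omega>\<close> differ by one term of its series and
  \<open>Im \<phi>\<close> solves the unperturbed recurrence (\<open>z\<close> is real).
  For the asymptotics, \<open>\<phi>\<close> is multiplied by \<open>\<mu> = cis (\<theta> z)\<close> over a period, so the products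
  \<open>Im \<phi>\<^sub>m Im \<phi>\<^sub>m\<^sub>-\<^sub>1\<close> split into a periodic part of mean \<open>\<kappa> = C / (2 T)\<close> and a part multiplied by
  \<open>\<mu>\<^sup>2 \<noteq> 1\<close> over a period; their partial sums stay within a bounded distance of \<open>N \<kappa>\<close>.
  Hence \<open>\<omega>\<^sub>n = \<kappa> / (\<alpha> - 1) n powr (1 - \<alpha>) + O(n powr (- \<alpha>))\<close>, and to leading order
  \<open>q\<^sub>n\<close> is \<open>(\<alpha> - 1) / (\<kappa> n)\<close> times a quadratic expression in \<open>Im \<phi>\<close>, which on each residue class
  mod \<open>T\<close> is a constant plus a sinusoid of frequency \<open>2 \<theta> / T\<close>.\<close>

subsection \<open>Quasi-periodic sequences\<close>

lemma quasi_periodic_power: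
  fixes f :: "nat \<Rightarrow> complex"
  assumes "\<And>n. f (n + T) = \<nu> * f n"
  shows "f (n + k * T) = \<nu> ^ k * f n"
proof (induction k)
  case (Suc k)
  have "f (n + Suc k * T) = f (n + k * T + T)" by (simp add: algebra_simps)
  then show ?case by (simp add: assms Suc)
qed simp

lemma quasi_periodic_bounded:
  fixes f :: "nat \<Rightarrow> complex"
  assumes per: "\<And>n. f (n + T) = \<nu> * f n" and nu: "cmod \<nu> = 1" and T: "T \<ge> 1"
  shows "\<exists>K. \<forall>n. cmod (f n) \<le> K"
proof (intro exI allI)
  fix n
  have "f n = \<nu> ^ (n div T) * f (n mod T)"
    using quasi_periodic_power[of f T \<nu> "n mod T" "n div T", OF per] by (simp add: add.commute)
  then have "cmod (f n) = cmod (f (n mod T))" by (simp add: norm_mult norm_power nu)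
  also have "\<dots> \<le> (\<Sum>i<T. cmod (f i))"
    using T by (intro member_le_sum) auto
  finally show "cmod (f n) \<le> (\<Sum>i<T. cmod (f i))" .
qed

text \<open>Split the sum over \<open>N + T\<close> indices once after \<open>T\<close> and once
  after \<open>N\<close> terms. A difference of two long sums becomes one of two sums of fixed
  length \<open>T\<close>.\<close>

lemma sum_shift_diff:
  fixes f :: "nat \<Rightarrow> 'a::ab_group_add"
  shows "(\<Sum>i<N. f (i + T)) - (\<Sum>i<N. f i) = (\<Sum>i<T. f (i + N)) - (\<Sum>i<T. f i)"
proof -
  have *: "(\<Sum>i<N + T. f i) = (\<Sum>i<T. f i) + (\<Sum>i<N. f (i + T))" for N T
    by (induction N) (simp_all add: algebra_simps)
  have "(\<Sum>i<T. f i) + (\<Sum>i<N. f (i + T)) = (\<Sum>i<N. f i) + (\<Sum>i<T. f (i + N))"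
    using *[of N T] *[of T N] by (simp add: add.commute)
  then show ?thesis by (simp add: algebra_simps)
qed

text \<open>As for a geometric series: multiplication by \<open>\<nu> - 1\<close> turns the sum into
  a shifted sum minus itself, so only two blocks of length \<open>T\<close> survive.\<close>

lemma quasi_periodic_sum_bounded:
  fixes f :: "nat \<Rightarrow> complex"
  assumes per: "\<And>n. f (n + T) = \<nu> * f n" and nu: "cmod \<nu> = 1" "\<nu> \<noteq> 1" and T: "T \<ge> 1"
  shows "\<exists>B. \<forall>N. cmod (\<Sum>i<N. f i) \<le> B"
proof -
  obtain K where K: "\<And>n. cmod (f n) \<le> K" using quasi_periodic_bounded[of f T \<nu>] assms by blast
  have "cmod (\<Sum>i<N. f i) \<le> 2 * real T * K / cmod (\<nu> - 1)" for N
  proof -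
    have "(\<nu> - 1) * (\<Sum>i<N. f i) = (\<Sum>i<N. f (i + T)) - (\<Sum>i<N. f i)"
      by (simp add: per left_diff_distrib flip: sum_distrib_left)
    then have "(\<nu> - 1) * (\<Sum>i<N. f i) = (\<Sum>i<T. f (i + N)) - (\<Sum>i<T. f i)"
      by (simp only: sum_shift_diff[of f T N])
    moreover have "cmod (\<Sum>i<T. f (i + N)) \<le> real T * K" "cmod (\<Sum>i<T. f i) \<le> real T * K"
      using sum_norm_bound[of "{..<T}" "\<lambda>i. f (i + N)" K] sum_norm_bound[of "{..<T}" f K] K
      by auto
    ultimately have "cmod (\<nu> - 1) * cmod (\<Sum>i<N. f i) \<le> 2 * real T * K"
      using norm_triangle_ineq4[of "\<Sum>i<T. f (i + N)" "\<Sum>i<T. f i"]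
      by (simp flip: norm_mult)
    then show ?thesis using nu(2) by (simp add: field_simps)
  qed
  then show ?thesis by blast
qed

text \<open>The deviation from linear growth is itself \<open>T\<close>-periodic in
  \<open>N\<close>, hence bounded.\<close>

lemma periodic_sum_bounded:
  fixes f :: "nat \<Rightarrow> complex"
  assumes per: "\<And>n. f (n + T) = f n" and T: "T \<ge> 1"
  shows "\<exists>B. \<forall>N. cmod ((\<Sum>i<N. f i) - of_nat N * ((\<Sum>i<T. f i) / of_nat T)) \<le> B"
proof -
  define H where "H N = (\<Sum>i<N. f i) - of_nat N * ((\<Sum>i<T. f i) / of_nat T)" for N
  have "H (N + T) = 1 * H N" for N
  proof -
    have "(\<Sum>i<N + T. f i) = (\<Sum>i<N. f i) + (\<Sum>i<T. f (i + N))" for T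
      by (induction T) (simp_all add: algebra_simps)
    then have "(\<Sum>i<N + T. f i) = (\<Sum>i<N. f i) + (\<Sum>i<T. f (i + N))" .
    moreover have "(\<Sum>i<T. f (i + N)) = (\<Sum>i<T. f i)"
      using sum_shift_diff[of f T N] by (simp add: per)
    ultimately show ?thesis using T by (simp add: H_def field_simps)
  qed
  from quasi_periodic_bounded[of H T 1, OF this _ T] show ?thesis by (simp add: H_def)
qed

subsection \<open>Tails of weighted series with bounded mean deviation\<close>

text \<open>Summation by parts: the decrements of \<open>f\<close> are nonnegative and
  telescope.\<close>

lemma abel_bound:
  fixes f h :: "nat \<Rightarrow> real"
  assumes f: "\<And>i. f (Suc i) \<le> f i" "\<And>i. f i \<ge> 0" and B: "\<And>N. \<bar>\<Sum>i<N. h i\<bar> \<le> B"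
  shows "\<bar>\<Sum>i<N. f i * h i\<bar> \<le> B * f 0"
proof -
  define H where "H N = (\<Sum>i<N. h i)" for N
  \<comment> \<open>Bounding by \<open>f 0 - f N\<close> instead of \<open>f 0\<close> leaves
    exactly the room \<open>B * f N\<close> that the boundary term takes up.\<close>
  have "\<bar>(\<Sum>i<N. f i * h i) - f N * H N\<bar> \<le> B * (f 0 - f N)"
  proof (induction N)
    case (Suc N)
    have "\<bar>(f N - f (Suc N)) * H (Suc N)\<bar> \<le> (f N - f (Suc N)) * B"
      unfolding abs_mult using f(1)[of N] B[of "Suc N"] by (intro mult_mono) (auto simp: H_def)
    moreover have "(\<Sum>i<Suc N. f i * h i) - f (Suc N) * H (Suc N) =
       ((\<Sum>i<N. f i * h i) - f N * H N) + (f N - f (Suc N)) * H (Suc N)"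
      by (simp add: H_def algebra_simps)
    ultimately show ?case using Suc by (simp add: algebra_simps)
  qed (simp add: H_def)
  moreover have "\<bar>f N * H N\<bar> \<le> f N * B"
    unfolding abs_mult using f(2)[of N] B[of N] by (intro mult_mono) (auto simp: H_def)
  ultimately show ?thesis by (simp add: algebra_simps)
qed

text \<open>Integral comparison: by the mean value theorem the quotient equals
  \<open>t powr (- \<alpha>)\<close> for some \<open>t\<close> between \<open>x\<close> and
  \<open>x + 1\<close>.\<close>

lemma powr_diff_bounds:
  fixes x \<alpha> :: real
  assumes "x > 0" "\<alpha> > 1"
  shows "(x + 1) powr (- \<alpha>) \<le> (x powr (1 - \<alpha>) - (x + 1) powr (1 - \<alpha>)) / (\<alpha> - 1)"
    and "(x powr (1 - \<alpha>) - (x + 1) powr (1 - \<alpha>)) / (\<alpha> - 1) \<le> x powr (- \<alpha>)"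
proof -
  have "\<exists>t. x < t \<and> t < x + 1 \<and>
      (x + 1) powr (1 - \<alpha>) - x powr (1 - \<alpha>) = (x + 1 - x) * ((1 - \<alpha>) * t powr (1 - \<alpha> - 1))"
    using assms by (intro MVT2) (auto intro!: derivative_eq_intros)
  then obtain t where t: "x < t" "t < x + 1"
    "(x powr (1 - \<alpha>) - (x + 1) powr (1 - \<alpha>)) / (\<alpha> - 1) = t powr (- \<alpha>)"
    using assms by (auto simp: field_simps)
  show "(x + 1) powr (- \<alpha>) \<le> (x powr (1 - \<alpha>) - (x + 1) powr (1 - \<alpha>)) / (\<alpha> - 1)"
    unfolding t(3) using t assms by (intro powr_mono2') auto
  show "(x powr (1 - \<alpha>) - (x + 1) powr (1 - \<alpha>)) / (\<alpha> - 1) \<le> x powr (- \<alpha>)"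
    unfolding t(3) using t assms by (intro powr_mono2') auto
qed

lemma summable_powr_tail:
  fixes \<alpha> :: real
  assumes "\<alpha> > 1"
  shows "summable (\<lambda>i. real (n + i) powr (- \<alpha>))"
proof -
  have "summable (\<lambda>i. real i powr (- \<alpha>))"
    using assms by (simp add: summable_real_powr_iff)
  then show ?thesis
    using summable_iff_shift[of "\<lambda>i. real i powr (- \<alpha>)" n] by (simp add: add.commute)
qed

lemma powr_tail_asymp:
  fixes \<alpha> :: real
  assumes \<alpha>: "\<alpha> > 1" and n: "n \<ge> 1"
  shows "\<bar>(\<Sum>i. real (n + 1 + i) powr (- \<alpha>)) - real n powr (1 - \<alpha>) / (\<alpha> - 1)\<bar> \<le> real n powr (- \<alpha>)"
proof -
  \<comment> \<open>\<open>F i\<close> is the integral of \<open>t powr (- \<alpha>)\<close> from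
    \<open>n + i\<close> to infinity. Its decrements lie between consecutive terms of the series,
    which squeezes \<open>F 0\<close> between the tails starting at \<open>n + 1\<close> and at
    \<open>n\<close>.\<close>
  define F where "F i = real (n + i) powr (1 - \<alpha>) / (\<alpha> - 1)" for i
  have "F \<longlonglongrightarrow> 0"
    unfolding F_def using \<alpha> by real_asymp
  from telescope_sums'[OF this]
  have tel: "(\<lambda>i. F i - F (Suc i)) sums F 0" by simp
  have le1: "real (n + 1 + i) powr (- \<alpha>) \<le> F i - F (Suc i)"
    and le2: "F i - F (Suc i) \<le> real (n + i) powr (- \<alpha>)" for i
    using powr_diff_bounds[of "real (n + i)" \<alpha>] n \<alpha>
    by (simp_all add: F_def add_ac diff_divide_distrib)
  have "(\<Sum>i. real (n + 1 + i) powr (- \<alpha>)) \<le> F 0"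
    unfolding sums_unique[OF tel]
    using le1 summable_powr_tail[OF \<alpha>, of "n + 1"] sums_summable[OF tel] by (intro suminf_le) auto
  moreover have "F 0 \<le> (\<Sum>i. real (n + i) powr (- \<alpha>))"
    unfolding sums_unique[OF tel]
    using le2 summable_powr_tail[OF \<alpha>] sums_summable[OF tel] by (intro suminf_le) auto
  moreover have "(\<Sum>i. real (n + i) powr (- \<alpha>)) = real n powr (- \<alpha>) + (\<Sum>i. real (n + 1 + i) powr (- \<alpha>))"
    using suminf_split_head[OF summable_powr_tail[OF \<alpha>, of n]] by simp
  ultimately show ?thesis by (simp add: F_def)
qed

lemma summable_powr_mult_bounded:
  fixes g :: "nat \<Rightarrow> real"
  assumes \<alpha>: "\<alpha> > 1" and K: "\<And>i. \<bar>g i\<bar> \<le> K"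
  shows "summable (\<lambda>i. real (n + i) powr (- \<alpha>) * g i)"
proof (rule summable_comparison_test')
  show "summable (\<lambda>i. real (n + i) powr (- \<alpha>) * K)"
    by (rule summable_mult2[OF summable_powr_tail[OF \<alpha>]])
  show "norm (real (n + i) powr (- \<alpha>) * g i) \<le> real (n + i) powr (- \<alpha>) * K" if "i \<ge> 0" for i
    using K[of i] by (auto simp: abs_mult intro: mult_left_mono)
qed

text \<open>Abel summation makes the fluctuation of \<open>g\<close> around its mean contribute only
  \<open>O(n powr (- \<alpha>))\<close>, one order below the main term.\<close>

lemma weighted_tail_asymp:
  fixes g :: "nat \<Rightarrow> real"
  assumes \<alpha>: "\<alpha> > 1" and B: "\<And>N. \<bar>(\<Sum>i<N. g i) - real N * \<kappa>\<bar> \<le> B"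
  shows "\<exists>D. \<forall>n\<ge>1. \<bar>(\<Sum>i. real (n + 1 + i) powr (- \<alpha>) * g (n + i))
            - \<kappa> / (\<alpha> - 1) * real n powr (1 - \<alpha>)\<bar> \<le> D * real n powr (- \<alpha>)"
proof (intro exI allI impI)
  fix n :: nat assume n: "n \<ge> 1"
  define w where "w i = real (n + 1 + i) powr (- \<alpha>)" for i
  define h where "h i = g (n + i) - \<kappa>" for i
  have B0: "B \<ge> 0" using B[of 0] by simp
  \<comment> \<open>A block starting at \<open>n\<close> is a difference of two initial segments, so
    its bound \<open>2 * B\<close> is uniform in \<open>n\<close>.\<close>
  have shift: "(\<Sum>i<N. h i) = ((\<Sum>i<n + N. g i) - real (n + N) * \<kappa>) - ((\<Sum>i<n. g i) - real n * \<kappa>)" for N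
    by (induction N) (simp_all add: h_def algebra_simps)
  have hB: "\<bar>\<Sum>i<N. h i\<bar> \<le> 2 * B" for N
    unfolding shift using B[of "n + N"] B[of n] by linarith
  have "\<bar>h i\<bar> \<le> 4 * B" for i
    using hB[of "Suc i"] hB[of i] by simp
  then have sh: "summable (\<lambda>i. w i * h i)"
    unfolding w_def by (rule summable_powr_mult_bounded[OF \<alpha>])
  have sw: "summable w" unfolding w_def by (rule summable_powr_tail[OF \<alpha>])
  have "\<bar>\<Sum>i<N. w i * h i\<bar> \<le> 2 * B * w 0" for N
  proof (rule abel_bound)
    show "w (Suc i) \<le> w i" for i
      unfolding w_def using \<alpha> by (intro powr_mono2') auto
  qed (use hB in \<open>auto simp: w_def\<close>)
  moreover have "(\<lambda>N. \<bar>\<Sum>i<N. w i * h i\<bar>) \<longlonglongrightarrow> \<bar>\<Sum>i. w i * h i\<bar>"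
    by (intro tendsto_intros summable_LIMSEQ sh)
  ultimately have "\<bar>\<Sum>i. w i * h i\<bar> \<le> 2 * B * w 0"
    by (intro LIMSEQ_le_const2) auto
  also have "\<dots> \<le> 2 * B * real n powr (- \<alpha>)"
    unfolding w_def using n \<alpha> B0 by (intro mult_left_mono powr_mono2') auto
  finally have 1: "\<bar>\<Sum>i. w i * h i\<bar> \<le> 2 * B * real n powr (- \<alpha>)" .
  have "(\<Sum>i. w i * g (n + i)) = (\<Sum>i. w i * h i + \<kappa> * w i)"
    by (simp add: h_def algebra_simps)
  also have "\<dots> = (\<Sum>i. w i * h i) + \<kappa> * (\<Sum>i. w i)"
    using sh sw by (subst suminf_add[symmetric]) (auto simp: suminf_mult summable_mult)
  finally have 2: "(\<Sum>i. w i * g (n + i)) = (\<Sum>i. w i * h i) + \<kappa> * (\<Sum>i. w i)" .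
  have "\<bar>\<kappa> * (\<Sum>i. w i) - \<kappa> / (\<alpha> - 1) * real n powr (1 - \<alpha>)\<bar> =
        \<bar>\<kappa>\<bar> * \<bar>(\<Sum>i. w i) - real n powr (1 - \<alpha>) / (\<alpha> - 1)\<bar>"
    by (simp add: right_diff_distrib flip: abs_mult)
  also have "\<dots> \<le> \<bar>\<kappa>\<bar> * real n powr (- \<alpha>)"
    unfolding w_def using powr_tail_asymp[OF \<alpha> n] by (intro mult_left_mono) auto
  finally show "\<bar>(\<Sum>i. real (n + 1 + i) powr (- \<alpha>) * g (n + i))
            - \<kappa> / (\<alpha> - 1) * real n powr (1 - \<alpha>)\<bar> \<le> (2 * B + \<bar>\<kappa>\<bar>) * real n powr (- \<alpha>)"
    using 1 2 by (simp add: w_def distrib_right)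
qed

section \<open>Reciprocals of the tails\<close>

lemma inverse_tail_asymp:
  fixes W :: "nat \<Rightarrow> real" and \<alpha> A D :: real
  assumes A: "A \<noteq> 0"
    and D: "\<And>n. n \<ge> L \<Longrightarrow> \<bar>W n - A * real n powr (1 - \<alpha>)\<bar> \<le> D * real n powr (- \<alpha>)"
  shows "eventually (\<lambda>n. W n \<noteq> 0) sequentially"
    and "(\<lambda>n. real n powr (- \<alpha>) / W n - 1 / (A * real n)) \<in> O(\<lambda>n. 1 / (real n)\<^sup>2)"
    and "(\<lambda>n. real (n + 1) powr (- \<alpha>) / W n - 1 / (A * real n)) \<in> O(\<lambda>n. 1 / (real n)\<^sup>2)"
proof -
  \<comment> \<open>Scaling by \<open>real n powr \<alpha>\<close> turns the hypothesis into
    \<open>V n = A * real n + O(1)\<close>, whose reciprocal is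
    \<open>1 / (A * real n) + O(1 / n^2)\<close>.\<close>
  define V where "V n = W n * real n powr \<alpha>" for n
  have V: "\<bar>V n - A * real n\<bar> \<le> D" if "n \<ge> L" "n \<ge> 1" for n
  proof -
    have "V n - A * real n = (W n - A * real n powr (1 - \<alpha>)) * real n powr \<alpha>"
      using that by (simp add: V_def left_diff_distrib powr_diff powr_minus)
    also have "\<bar>\<dots>\<bar> \<le> D * real n powr (- \<alpha>) * real n powr \<alpha>"
      unfolding abs_mult using D[OF that(1)] by (intro mult_mono) auto
    also have "\<dots> = D" using that by (simp add: powr_minus)
    finally show ?thesis .
  qed
  have "eventually (\<lambda>n. D \<le> \<bar>A\<bar> * real n / 2) sequentially"
    using A by real_asymp
  then have ev: "eventually (\<lambda>n. n \<ge> L \<and> n \<ge> 1 \<and> \<bar>V n\<bar> \<ge> \<bar>A\<bar> * real n / 2) sequentially"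
    using eventually_ge_at_top[of L] eventually_ge_at_top[of 1]
  proof eventually_elim
    case (elim n)
    have "\<bar>A * real n\<bar> = \<bar>A\<bar> * real n" by (simp add: abs_mult)
    then show ?case using V[of n] elim by linarith
  qed
  show "eventually (\<lambda>n. W n \<noteq> 0) sequentially"
    using ev
  proof eventually_elim
    case (elim n)
    then have "\<bar>V n\<bar> > 0" using A by (intro less_le_trans[of 0 "\<bar>A\<bar> * real n / 2" "\<bar>V n\<bar>"]) auto
    then show ?case by (auto simp: V_def)
  qed
  have 1: "(\<lambda>n. real n powr (- \<alpha>) / W n - 1 / (A * real n)) \<in> O(\<lambda>n. 1 / (real n)\<^sup>2)"
  proof (rule bigoI)
    show "\<forall>\<^sub>F n in sequentially. norm (real n powr (- \<alpha>) / W n - 1 / (A * real n))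
             \<le> 2 * D / A\<^sup>2 * norm (1 / (real n)\<^sup>2)"
      using ev
    proof eventually_elim
      case (elim n)
      have pos: "\<bar>A\<bar> * real n / 2 > 0" using A elim by simp
      then have V0: "V n \<noteq> 0" using elim by auto
      have "real n powr (- \<alpha>) / W n = 1 / V n"
        using elim by (simp add: V_def powr_minus field_simps)
      \<comment> \<open>The numerator is at most \<open>D\<close> in modulus and the denominator at
        least \<open>A^2 * n^2 / 2\<close>, whence the constant
        \<open>2 * D / A\<^sup>2\<close>.\<close>
      also have "1 / V n - 1 / (A * real n) = - (V n - A * real n) / (A * real n * V n)"
        using A V0 elim by (simp add: field_simps)
      also have "\<bar>\<dots>\<bar> \<le> D / (\<bar>A\<bar> * real n * (\<bar>A\<bar> * real n / 2))"
        unfolding abs_divide abs_mult abs_minus using V[of n] elim pos A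
        by (intro frac_le mult_mono mult_pos_pos) auto
      also have "\<dots> = 2 * D / (\<bar>A\<bar>\<^sup>2 * (real n)\<^sup>2)"
        by (simp add: power2_eq_square mult_ac del: abs_mult_self_eq)
      also have "\<dots> = 2 * D / A\<^sup>2 * norm (1 / (real n)\<^sup>2)" by simp
      finally show ?case by simp
    qed
  qed
  then show "(\<lambda>n. real n powr (- \<alpha>) / W n - 1 / (A * real n)) \<in> O(\<lambda>n. 1 / (real n)\<^sup>2)" .
  have "(\<lambda>n::nat. 1 / (real n)\<^sup>2) \<in> O(\<lambda>n. 1 / real n)" "(\<lambda>n::nat. 1 / (A * real n)) \<in> O(\<lambda>n. 1 / real n)"
    using A by real_asymp+
  from sum_in_bigo(1)[OF landau_o.big_trans[OF 1 this(1)] this(2)] have 2: "(\<lambda>n. real n powr (- \<alpha>) / W n) \<in> O(\<lambda>n. 1 / real n)" by simp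
  \<comment> \<open>Passing from \<open>n\<close> to \<open>n + 1\<close> in the numerator is a
    relative change of \<open>O(1 / n)\<close> in a quantity of size
    \<open>O(1 / n)\<close>.\<close>
  have 3: "(\<lambda>n. real (n + 1) powr (- \<alpha>) / real n powr (- \<alpha>) - 1) \<in> O(\<lambda>n. 1 / real n)"
    by real_asymp
  have "(\<lambda>n. (real (n + 1) powr (- \<alpha>) / real n powr (- \<alpha>) - 1) * (real n powr (- \<alpha>) / W n))
          \<in> O(\<lambda>n. 1 / real n * (1 / real n))"
    by (rule landau_o.big.mult[OF 3 2])
  then have "(\<lambda>n. (real (n + 1) powr (- \<alpha>) / real n powr (- \<alpha>) - 1) * (real n powr (- \<alpha>) / W n))
          \<in> O(\<lambda>n. 1 / (real n)\<^sup>2)"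
    by (simp add: power2_eq_square)
  note 4 = sum_in_bigo(1)[OF this 1]
  show "(\<lambda>n. real (n + 1) powr (- \<alpha>) / W n - 1 / (A * real n)) \<in> O(\<lambda>n. 1 / (real n)\<^sup>2)"
  proof (rule landau_o.big.in_cong[THEN iffD1, OF _ 4])
    show "\<forall>\<^sub>F n in sequentially.
       (real (n + 1) powr (- \<alpha>) / real n powr (- \<alpha>) - 1) * (real n powr (- \<alpha>) / W n)
          + (real n powr (- \<alpha>) / W n - 1 / (A * real n))
       = real (n + 1) powr (- \<alpha>) / W n - 1 / (A * real n)"
      \<comment> \<open>At \<open>n = 0\<close> the power \<open>real n powr (- \<alpha>)\<close> is
        0 and does not cancel.\<close>
      using eventually_gt_at_top[of 0] by eventually_elim (simp add: left_diff_distrib diff_divide_distrib)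
  qed
qed

subsection \<open>Transfer matrices and Bloch solutions\<close>

lemma one_step_matrix_carrier: "one_step_matrix a z j \<in> carrier_mat 2 2"
  by (simp add: one_step_matrix_def mat_of_rows_list_def numeral_2_eq_2)

lemma transfer_product_carrier: "transfer_product a z j \<in> carrier_mat 2 2"
  by (induction j) (auto intro: mult_carrier_mat one_step_matrix_carrier)

declare transfer_product.simps(2) [simp del] bloch.simps(3) [simp del]

text \<open>The first row of a one-step matrix is (0, 1), so each step moves the lower row up and
  puts the next value of the three-term recurrence below it.\<close>

lemma transfer_product_Suc_entries:
  assumes "k < 2"
  shows "transfer_product a z (Suc j) $$ (0, k) = transfer_product a z j $$ (1, k)"
    and "transfer_product a z (Suc j) $$ (1, k) =
      (z * transfer_product a z j $$ (1, k) - of_real (a j) * transfer_product a z j $$ (0, k))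
        / of_real (a (Suc j))"
proof -
  have dims: "dim_row (transfer_product a z j) = 2" "dim_col (transfer_product a z j) = 2"
    "dim_row (one_step_matrix a z (Suc j)) = 2" "dim_col (one_step_matrix a z (Suc j)) = 2"
    using transfer_product_carrier[of a z j] one_step_matrix_carrier[of a z "Suc j"] by auto
  have B: "one_step_matrix a z (Suc j) $$ (0, 0) = 0" "one_step_matrix a z (Suc j) $$ (0, 1) = 1"
    "one_step_matrix a z (Suc j) $$ (1, 0) = - of_real (a j / a (Suc j))"
    "one_step_matrix a z (Suc j) $$ (1, 1) = z / of_real (a (Suc j))"
    by (simp_all add: one_step_matrix_def mat_of_rows_list_def)
  have sum2: "(\<Sum>i\<in>{0..<2}. f i) = f 0 + f 1" for f :: "nat \<Rightarrow> complex"
    by (simp add: numeral_2_eq_2)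
  have "transfer_product a z (Suc j) $$ (i, k) =
      one_step_matrix a z (Suc j) $$ (i, 0) * transfer_product a z j $$ (0, k) +
      one_step_matrix a z (Suc j) $$ (i, 1) * transfer_product a z j $$ (1, k)" if "i < 2" for i
    using that assms dims by (simp add: scalar_prod_def sum2 transfer_product.simps(2))
  from this[of 0] this[of 1] B
  show "transfer_product a z (Suc j) $$ (0, k) = transfer_product a z j $$ (1, k)"
    and "transfer_product a z (Suc j) $$ (1, k) =
      (z * transfer_product a z j $$ (1, k) - of_real (a j) * transfer_product a z j $$ (0, k))
        / of_real (a (Suc j))"
    by (simp_all add: diff_divide_distrib)
qed

lemma transfer_product_Reals:
  assumes z: "z \<in> \<real>" and k: "k < 2"
  shows "transfer_product a z j $$ (0, k) \<in> \<real> \<and> transfer_product a z j $$ (1, k) \<in> \<real>"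
proof (induction j)
  case 0
  then show ?case using k by auto
next
  case (Suc j)
  then show ?case
    unfolding transfer_product_Suc_entries[OF k] using z by (auto intro!: Reals_divide)
qed

text \<open>At \<open>j = T\<close> this identifies the monodromy matrix with the period map of the
  recurrence.\<close>

lemma transfer_product_solution:
  assumes rec: "\<And>n. \<psi> (Suc (Suc n)) = (z * \<psi> (Suc n) - of_real (a n) * \<psi> n) / of_real (a (Suc n))"
  shows "\<psi> j = transfer_product a z j $$ (0, 0) * \<psi> 0 + transfer_product a z j $$ (0, 1) * \<psi> 1 \<and>
    \<psi> (Suc j) = transfer_product a z j $$ (1, 0) * \<psi> 0 + transfer_product a z j $$ (1, 1) * \<psi> 1"
proof (induction j)
  case (Suc j)
  then have IH: "\<psi> j = transfer_product a z j $$ (0, 0) * \<psi> 0 + transfer_product a z j $$ (0, 1) * \<psi> 1"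
    "\<psi> (Suc j) = transfer_product a z j $$ (1, 0) * \<psi> 0 + transfer_product a z j $$ (1, 1) * \<psi> 1"
    by auto
  have lt: "(0::nat) < 2" "(1::nat) < 2" by simp_all
  show ?case
    unfolding rec[of j] transfer_product_Suc_entries[OF lt(1)] transfer_product_Suc_entries[OF lt(2)] IH
    by (simp add: add_divide_distrib diff_divide_distrib algebra_simps)
qed simp

lemma eigenvalue_2x2D:
  fixes A :: "complex mat"
  assumes A: "A \<in> carrier_mat 2 2" and ev: "eigenvalue A \<nu>"
  obtains x y where "x \<noteq> 0 \<or> y \<noteq> 0"
    "A $$ (0, 0) * x + A $$ (0, 1) * y = \<nu> * x" "A $$ (1, 0) * x + A $$ (1, 1) * y = \<nu> * y"
proof -
  obtain v where v: "v \<in> carrier_vec 2" "v \<noteq> 0\<^sub>v 2" "A *\<^sub>v v = \<nu> \<cdot>\<^sub>v v"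
    using ev A unfolding eigenvalue_def eigenvector_def by auto
  have sum2: "(\<Sum>i\<in>{0..<2}. f i) = f 0 + f 1" for f :: "nat \<Rightarrow> complex"
    by (simp add: numeral_2_eq_2)
  have eq: "A $$ (i, 0) * vec_index v 0 + A $$ (i, 1) * vec_index v 1 = \<nu> * vec_index v i"
    if "i < 2" for i
  proof -
    have "vec_index (A *\<^sub>v v) i = vec_index (\<nu> \<cdot>\<^sub>v v) i" using v(3) by simp
    then show ?thesis using that v(1) A by (simp add: scalar_prod_def sum2)
  qed
  have "vec_index v 0 \<noteq> 0 \<or> vec_index v 1 \<noteq> 0"
  proof (rule ccontr)
    assume "\<not> ?thesis"
    then have "v = 0\<^sub>v 2" using v(1) by (intro eq_vecI) (auto simp: less_2_cases_iff)
    with v(2) show False by simp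
  qed
  from that[OF this eq[of 0] eq[of 1]] show ?thesis by simp
qed

section \<open>Elliptic points: real spectral parameter and Floquet multiplier\<close>

locale elliptic_point =
  fixes a :: "nat \<Rightarrow> real" and T :: nat and \<theta> :: "complex \<Rightarrow> real" and z :: complex
  assumes T_pos: "T \<ge> 1"
    and a_pos_period: "\<And>j. 1 \<le> j \<Longrightarrow> j \<le> T \<Longrightarrow> a j > 0"
    and a_per: "\<And>n. a (n + T) = a n"
    and quasi: "quasi_momentum a T \<theta>"
    and elliptic: "z \<in> elliptic_points a T"
begin

abbreviation M where "M \<equiv> monodromy a T z"
abbreviation \<phi> where "\<phi> \<equiv> bloch a T \<theta> z"
abbreviation \<mu> where "\<mu> \<equiv> cis (\<theta> z)"
abbreviation y where "y n \<equiv> Im (\<phi> n)"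

lemma a_pos: "a n > 0"
proof (induction n rule: less_induct)
  case (less n)
  consider "n = 0" | "1 \<le> n" "n \<le> T" | "n > T" by linarith
  then show ?case
  proof cases
    case 1
    then show ?thesis using a_per[of 0] a_pos_period[of T] T_pos by simp
  next
    case 3
    then show ?thesis using less[of "n - T"] a_per[of "n - T"] T_pos by simp
  qed (rule a_pos_period)
qed

lemma a_per_power: "a (n + k * T) = a n"
proof (induction k)
  case (Suc k)
  have "a (n + Suc k * T) = a (n + k * T + T)" by (simp add: algebra_simps)
  then show ?case by (simp add: a_per Suc)
qed simp

lemma eigenvalues: "{\<nu>. eigenvalue M \<nu>} = {\<mu>, cnj \<mu>}"
proof -
  have "cnj \<mu> = cis (- \<theta> z)" by (simp add: complex_eq_iff)
  then have "cnj \<mu> = exp (- \<i> * of_real (\<theta> z))" by (simp add: cis_conv_exp)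
  then show ?thesis
    using quasi elliptic unfolding quasi_momentum_def by (simp add: cis_conv_exp)
qed

text \<open>Equality would leave a single eigenvalue, while ellipticity provides two. This is how
  ellipticity enters below: \<mu> is not real, and its square is not 1.\<close>

lemma mu_neq_cnj: "\<mu> \<noteq> cnj \<mu>"
proof
  assume *: "\<mu> = cnj \<mu>"
  obtain m1 m2 where m: "m1 \<noteq> m2" "eigenvalue M m1" "eigenvalue M m2"
    using elliptic unfolding elliptic_points_def by blast
  then have "m1 \<in> {\<nu>. eigenvalue M \<nu>}" "m2 \<in> {\<nu>. eigenvalue M \<nu>}" by simp_all
  then show False unfolding eigenvalues *[symmetric] using m(1) by simp
qed

lemma M_carrier: "M \<in> carrier_mat 2 2"
  by (simp add: monodromy_def transfer_product_carrier)

text \<open>The Wronskian of an eigenvector solution and its conjugate is preserved over a period,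
  while over one step it grows by \<open>Im z\<close> times the squared modulus.\<close>

lemma z_Reals: "z \<in> \<real>"
proof -
  have "eigenvalue M \<mu>" using eigenvalues by blast
  then obtain v w where vw: "v \<noteq> 0 \<or> w \<noteq> 0"
    "M $$ (0, 0) * v + M $$ (0, 1) * w = \<mu> * v" "M $$ (1, 0) * v + M $$ (1, 1) * w = \<mu> * w"
    using eigenvalue_2x2D[OF M_carrier] by metis
  \<comment> \<open>The solution of the recurrence whose initial data \<open>v\<close>,
    \<open>w\<close> form an eigenvector of \<open>M\<close>.\<close>
  define \<psi> where "\<psi> j = transfer_product a z j $$ (0, 0) * v + transfer_product a z j $$ (0, 1) * w" for j
  have \<psi>Suc: "\<psi> (Suc j) = transfer_product a z j $$ (1, 0) * v + transfer_product a z j $$ (1, 1) * w" for j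
    using transfer_product_Suc_entries(1)[of 0 a z j] transfer_product_Suc_entries(1)[of 1 a z j]
    by (simp add: \<psi>_def)
  have \<psi>01: "\<psi> 0 = v" "\<psi> 1 = w" using \<psi>Suc[of 0] by (simp_all add: \<psi>_def)
  have \<psi>T: "\<psi> T = \<mu> * v" "\<psi> (Suc T) = \<mu> * w"
    using vw unfolding \<psi>Suc by (simp_all add: \<psi>_def monodromy_def)
  have rec: "of_real (a n) * \<psi> n + of_real (a (Suc n)) * \<psi> (Suc (Suc n)) = z * \<psi> (Suc n)" for n
  proof -
    have lt: "(0::nat) < 2" "(1::nat) < 2" by simp_all
    have e: "of_real (a n) * transfer_product a z n $$ (0, k)
        + of_real (a (Suc n)) * transfer_product a z (Suc n) $$ (1, k)
        = z * transfer_product a z n $$ (1, k)" if "k < 2" for k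
      unfolding transfer_product_Suc_entries[OF that] using a_pos[of "Suc n"] by simp
    have "of_real (a n) * \<psi> n + of_real (a (Suc n)) * \<psi> (Suc (Suc n)) =
      (of_real (a n) * transfer_product a z n $$ (0, 0)
        + of_real (a (Suc n)) * transfer_product a z (Suc n) $$ (1, 0)) * v +
      (of_real (a n) * transfer_product a z n $$ (0, 1)
        + of_real (a (Suc n)) * transfer_product a z (Suc n) $$ (1, 1)) * w"
      unfolding \<psi>Suc by (simp add: \<psi>_def algebra_simps)
    also have "\<dots> = z * \<psi> (Suc n)"
      unfolding e[OF lt(1)] e[OF lt(2)] \<psi>Suc by (simp add: algebra_simps)
    finally show ?thesis .
  qed
  define W where "W n = a n * Im (\<psi> (Suc n) * cnj (\<psi> n))" for n
  have step: "W (Suc n) - W n = Im z * (cmod (\<psi> (Suc n)))\<^sup>2" for n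
  proof -
    \<comment> \<open>The recurrence is multiplied by \<open>cnj (\<psi> (Suc n))\<close>; the two
      terms on the left then have imaginary parts \<open>- W n\<close> and
      \<open>W (Suc n)\<close>.\<close>
    have "Im ((of_real (a n) * \<psi> n + of_real (a (Suc n)) * \<psi> (Suc (Suc n))) * cnj (\<psi> (Suc n)))
        = Im (z * (\<psi> (Suc n) * cnj (\<psi> (Suc n))))"
      unfolding rec by (simp only: mult.assoc)
    then show ?thesis
      by (simp add: W_def cmod_def power2_eq_square algebra_simps)
  qed
  have "W T - W 0 = Im z * (\<Sum>n<T. (cmod (\<psi> (Suc n)))\<^sup>2)"
    unfolding sum_distrib_left step[symmetric] by (rule sum_lessThan_telescope[symmetric])
  moreover have "W T = W 0"
  proof -
    have "\<psi> (Suc T) * cnj (\<psi> T) = (\<mu> * cnj \<mu>) * (w * cnj v)"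
      unfolding \<psi>T by simp
    also have "\<dots> = w * cnj v" by (simp add: cis_cnj cis_mult)
    finally show ?thesis using a_per[of 0] \<psi>01 by (simp add: W_def)
  qed
  \<comment> \<open>If the sum vanished, so would \<open>\<psi> 1 = w\<close> and
    \<open>\<psi> T = \<mu> * v\<close>, that is, the whole eigenvector.\<close>
  moreover have "(\<Sum>n<T. (cmod (\<psi> (Suc n)))\<^sup>2) \<noteq> 0"
  proof
    assume "(\<Sum>n<T. (cmod (\<psi> (Suc n)))\<^sup>2) = 0"
    then have zero: "\<psi> (Suc n) = 0" if "n < T" for n
      using that by (subst (asm) sum_nonneg_eq_0_iff) auto
    have "w = 0" using zero[of 0] T_pos \<psi>01 by simp
    moreover have "v = 0" using zero[of "T - 1"] T_pos \<psi>T(1) by simp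
    ultimately show False using vw(1) by simp
  qed
  ultimately have "Im z = 0" by simp
  then show ?thesis by (simp add: complex_is_Real_iff)
qed

lemma Im_z: "Im z = 0"
  using z_Reals by (simp add: complex_is_Real_iff)

text \<open>Otherwise \<open>M\<close> is triangular and \<mu> is one of its diagonal entries, which
  are real for real \<open>z\<close>. The division defining \<open>\<phi> 1\<close> is therefore
  genuine.\<close>

lemma M_entry_01_nonzero: "M $$ (0, 1) \<noteq> 0"
proof
  assume 0: "M $$ (0, 1) = 0"
  have "eigenvalue M \<mu>" using eigenvalues by blast
  then obtain v w where vw: "v \<noteq> 0 \<or> w \<noteq> 0"
    "M $$ (0, 0) * v + M $$ (0, 1) * w = \<mu> * v" "M $$ (1, 0) * v + M $$ (1, 1) * w = \<mu> * w"
    using eigenvalue_2x2D[OF M_carrier] by metis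
  then have "\<mu> = M $$ (0, 0) \<or> \<mu> = M $$ (1, 1)" using 0 by auto
  then have "\<mu> \<in> \<real>"
    using transfer_product_Reals[OF z_Reals, of 0 a T] transfer_product_Reals[OF z_Reals, of 1 a T]
    unfolding monodromy_def by auto
  then have "cnj \<mu> = \<mu>" by (simp only: Reals_cnj_iff)
  then show False using mu_neq_cnj by simp
qed

text \<open>The value of \<open>\<phi> 1\<close> is chosen to make (1, \<open>\<phi> 1\<close>) an
  eigenvector. The first row holds by that choice; it also makes every eigenvector for \<mu> a
  multiple of this one, which gives the second row.\<close>

lemma M_bloch: "M $$ (0, 0) + M $$ (0, 1) * \<phi> 1 = \<mu>" "M $$ (1, 0) + M $$ (1, 1) * \<phi> 1 = \<mu> * \<phi> 1"
proof -
  have \<phi>1: "\<phi> 1 = (\<mu> - M $$ (0, 0)) / M $$ (0, 1)" by (simp add: cis_conv_exp)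
  then show 1: "M $$ (0, 0) + M $$ (0, 1) * \<phi> 1 = \<mu>" using M_entry_01_nonzero by simp
  have "eigenvalue M \<mu>" using eigenvalues by blast
  then obtain v w where vw: "v \<noteq> 0 \<or> w \<noteq> 0"
    "M $$ (0, 0) * v + M $$ (0, 1) * w = \<mu> * v" "M $$ (1, 0) * v + M $$ (1, 1) * w = \<mu> * w"
    using eigenvalue_2x2D[OF M_carrier] by metis
  have "M $$ (0, 1) * w = (\<mu> - M $$ (0, 0)) * v"
    using vw(2) by (simp add: algebra_simps)
  also have "\<dots> = M $$ (0, 1) * (\<phi> 1 * v)"
    unfolding \<phi>1 using M_entry_01_nonzero by simp
  finally have w: "w = \<phi> 1 * v" using M_entry_01_nonzero by (metis mult_cancel_left)
  then have "v \<noteq> 0" using vw(1) by auto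
  moreover have "(M $$ (1, 0) + M $$ (1, 1) * \<phi> 1) * v = (\<mu> * \<phi> 1) * v"
    using vw(3) unfolding w by (simp add: algebra_simps)
  ultimately show "M $$ (1, 0) + M $$ (1, 1) * \<phi> 1 = \<mu> * \<phi> 1" by (metis mult_cancel_right)
qed

lemma bloch_shift: "\<phi> (n + T) = \<mu> * \<phi> n"
proof -
  \<comment> \<open>The recurrence has order two, so the induction carries two consecutive
    values.\<close>
  have "\<phi> (n + T) = \<mu> * \<phi> n \<and> \<phi> (Suc n + T) = \<mu> * \<phi> (Suc n)"
  proof (induction n)
    case 0
    have "\<phi> T = M $$ (0, 0) + M $$ (0, 1) * \<phi> 1 \<and> \<phi> (Suc T) = M $$ (1, 0) + M $$ (1, 1) * \<phi> 1"
      using transfer_product_solution[of \<phi> z a T] unfolding monodromy_def by (simp add: bloch.simps(3))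
    then show ?case using M_bloch by simp
  next
    case (Suc n)
    have "\<phi> (Suc (Suc n) + T) = \<phi> (Suc (Suc (n + T)))" by simp
    also have "\<dots> = (z * \<phi> (Suc n + T) - of_real (a (n + T)) * \<phi> (n + T)) / of_real (a (Suc n + T))"
      by (simp add: bloch.simps(3))
    also have "\<dots> = \<mu> * \<phi> (Suc (Suc n))"
      using Suc unfolding a_per bloch.simps(3)[of a T \<theta> z n]
      by (simp add: algebra_simps diff_divide_distrib)
    finally show ?case using Suc by blast
  qed
  then show ?thesis ..
qed

lemma bloch_shift_power: "\<phi> (n + k * T) = cis (real k * \<theta> z) * \<phi> n"
  using quasi_periodic_power[of \<phi> T \<mu> n k] bloch_shift by (simp add: DeMoivre)

lemma y_rec: "a n * y n + a (Suc n) * y (Suc (Suc n)) = Re z * y (Suc n)"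
proof -
  have "of_real (a n) * \<phi> n + of_real (a (Suc n)) * \<phi> (Suc (Suc n)) = z * \<phi> (Suc n)"
    using a_pos[of "Suc n"] by (simp add: bloch.simps(3))
  from arg_cong[OF this, of Im] show ?thesis by (simp add: Im_z)
qed

lemma y_bounded: "\<exists>K. \<forall>n. \<bar>y n\<bar> \<le> K"
proof -
  obtain K where "\<And>n. cmod (\<phi> n) \<le> K"
    using quasi_periodic_bounded[of \<phi> T \<mu>, OF bloch_shift norm_cis T_pos] by blast
  then show ?thesis using order_trans[OF abs_Im_le_cmod] by blast
qed

section \<open>Mean and fluctuation of the products of neighbouring values\<close>

definition \<kappa> where "\<kappa> = C_const a T \<theta> z / (2 * real T)"

lemma y_product_mean: "\<exists>B. \<forall>N. \<bar>(\<Sum>i<N. y (Suc i) * y i) - real N * \<kappa>\<bar> \<le> B"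
proof -
  define b where "b i = \<phi> (Suc i) * cnj (\<phi> i)" for i
  define w where "w i = \<phi> (Suc i) * \<phi> i" for i
  have mu1: "\<mu> * cnj \<mu> = 1" by (simp add: cis_cnj cis_mult)
  have "b (n + T) = b n" for n
  proof -
    have "b (n + T) = (\<mu> * cnj \<mu>) * b n"
      using bloch_shift[of "Suc n"] bloch_shift[of n] by (simp add: b_def)
    then show ?thesis unfolding mu1 by simp
  qed
  from periodic_sum_bounded[of b, OF this T_pos] obtain B1 where
    B1: "\<And>N. cmod ((\<Sum>i<N. b i) - of_nat N * ((\<Sum>i<T. b i) / of_nat T)) \<le> B1" by blast
  have "w (n + T) = \<mu>\<^sup>2 * w n" for n
    using bloch_shift[of "Suc n"] bloch_shift[of n] by (simp add: w_def power2_eq_square)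
  moreover have "\<mu>\<^sup>2 \<noteq> 1"
  proof
    assume "\<mu>\<^sup>2 = 1"
    then have "\<mu> * \<mu> = \<mu> * cnj \<mu>" unfolding mu1 by (simp add: power2_eq_square)
    then show False using mu_neq_cnj by simp
  qed
  ultimately obtain B2 where B2: "\<And>N. cmod (\<Sum>i<N. w i) \<le> B2"
    using quasi_periodic_sum_bounded[of w T "\<mu>\<^sup>2"] T_pos by (auto simp: norm_power)
  have C: "\<kappa> = Re ((\<Sum>i<T. b i) / of_nat T) / 2"
    by (simp add: \<kappa>_def C_const_def b_def sum.atLeast1_atMost_eq Re_divide_of_nat)
  have "\<bar>(\<Sum>i<N. y (Suc i) * y i) - real N * \<kappa>\<bar> \<le> (B1 + B2) / 2" for N
  proof -
    \<comment> \<open>From \<open>Im p * Im q = (Re (p * cnj q) - Re (p * q)) / 2\<close>, which is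
      also the origin of the 2 in \<open>\<kappa>\<close>.\<close>
    have "(\<Sum>i<N. y (Suc i) * y i) = (Re (\<Sum>i<N. b i) - Re (\<Sum>i<N. w i)) / 2"
      by (simp add: b_def w_def sum_subtractf[symmetric] sum_divide_distrib mult.commute)
    then have "(\<Sum>i<N. y (Suc i) * y i) - real N * \<kappa> =
       (Re ((\<Sum>i<N. b i) - of_nat N * ((\<Sum>i<T. b i) / of_nat T)) - Re (\<Sum>i<N. w i)) / 2"
      unfolding C by (simp add: field_simps)
    moreover have "\<bar>p - q\<bar> \<le> B1 + B2" if "\<bar>p\<bar> \<le> B1" "\<bar>q\<bar> \<le> B2" for p q :: real
      using that abs_triangle_ineq4[of p q] by linarith
    note this[OF order_trans[OF abs_Re_le_cmod B1[of N]] order_trans[OF abs_Re_le_cmod B2[of N]]]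
    ultimately show ?thesis by (simp only: abs_divide) simp
  qed
  then show ?thesis by blast
qed

subsection \<open>The weights and the perturbed recurrence\<close>

lemma omega_eq:
  "omega a T \<theta> \<alpha> c z n =
    (\<Sum>i. c (n + 1 + i) * (real (n + 1 + i) powr (- \<alpha>) * (y (Suc (n + i)) * y (n + i))))"
  by (simp add: omega_def mult.assoc)

text \<open>A \<open>suminf\<close> can be split only if its series converges. Bounded
  \<open>y\<close> and \<open>\<alpha> > 1\<close> give convergence, and finitely many factors do
  not affect it.\<close>

lemma omega_summable:
  assumes \<alpha>: "\<alpha> > 1" and c: "\<And>m. m \<ge> L \<Longrightarrow> c m = 1"
  shows "summable (\<lambda>i. c (n + 1 + i) * (real (n + 1 + i) powr (- \<alpha>) * (y (Suc (n + i)) * y (n + i))))"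
proof -
  obtain K where K: "\<And>n. \<bar>y n\<bar> \<le> K" using y_bounded by blast
  have "\<bar>y (Suc (n + i)) * y (n + i)\<bar> \<le> K * K" for i
    unfolding abs_mult using K[of 0] by (intro mult_mono K) auto
  then have "summable (\<lambda>i. real (n + 1 + i) powr (- \<alpha>) * (y (Suc (n + i)) * y (n + i)))"
    by (rule summable_powr_mult_bounded[OF \<alpha>])
  moreover have "\<forall>\<^sub>F i in sequentially.
      c (n + 1 + i) * (real (n + 1 + i) powr (- \<alpha>) * (y (Suc (n + i)) * y (n + i)))
        = real (n + 1 + i) powr (- \<alpha>) * (y (Suc (n + i)) * y (n + i))"
    using eventually_ge_at_top[of L] by eventually_elim (simp add: c)
  ultimately show ?thesis by (subst summable_cong) auto
qed

lemma omega_step: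
  assumes "\<alpha> > 1" and "\<And>m. m \<ge> L \<Longrightarrow> c m = 1"
  shows "omega a T \<theta> \<alpha> c z n =
    c (Suc n) * real (Suc n) powr (- \<alpha>) * y (Suc n) * y n + omega a T \<theta> \<alpha> c z (Suc n)"
  using suminf_split_head[OF omega_summable[of \<alpha> L c n, OF assms]]
  unfolding omega_eq by (simp add: mult.assoc)

text \<open>The series of index \<open>n\<close> starts with the factor \<open>c (Suc n)\<close>, so
  \<open>Suc n\<close> has to reach \<open>L\<close>, not \<open>n\<close>.\<close>

lemma omega_eventually_unmodified:
  assumes c: "\<And>m. m \<ge> L \<Longrightarrow> c m = 1" and n: "Suc n \<ge> L"
  shows "omega a T \<theta> \<alpha> c z n = omega a T \<theta> \<alpha> (\<lambda>_. 1) z n"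
  using n by (simp add: omega_eq c)

lemma omega_asymp:
  assumes "\<alpha> > 1"
  shows "\<exists>D. \<forall>n\<ge>1. \<bar>omega a T \<theta> \<alpha> (\<lambda>_. 1) z n - \<kappa> / (\<alpha> - 1) * real n powr (1 - \<alpha>)\<bar>
            \<le> D * real n powr (- \<alpha>)"
proof -
  obtain B where B: "\<And>N. \<bar>(\<Sum>i<N. y (Suc i) * y i) - real N * \<kappa>\<bar> \<le> B"
    using y_product_mean by blast
  show ?thesis using weighted_tail_asymp[OF assms B] by (simp add: omega_eq)
qed

text \<open>Merges both cases of the convention into the two facts used later.\<close>

lemma admissible_factorsD:
  assumes "admissible_factors a T \<theta> \<alpha> z c"
  obtains L where "\<And>m. m \<ge> L \<Longrightarrow> c m = 1" "\<And>n. n \<ge> 1 \<Longrightarrow> omega a T \<theta> \<alpha> c z n \<noteq> 0"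
proof (cases "\<forall>n\<ge>1. omega a T \<theta> \<alpha> (\<lambda>_. 1) z n \<noteq> 0")
  case True
  then have "c = (\<lambda>_. 1)" using assms unfolding admissible_factors_def by simp
  then show ?thesis using True that by simp
next
  case False
  then show ?thesis using assms that unfolding admissible_factors_def if_not_P[OF False] by blast
qed

text \<open>Dropping finitely many terms makes \<open>omega\<close> constant below the cut, so the factors 0 and 1
  already realise the convention on zeros.\<close>

lemma admissible_factors_exist:
  assumes \<alpha>: "\<alpha> > 1" and C: "C_const a T \<theta> z \<noteq> 0"
  shows "\<exists>c. admissible_factors a T \<theta> \<alpha> z c"
proof (cases "\<forall>n\<ge>1. omega a T \<theta> \<alpha> (\<lambda>_. 1) z n \<noteq> 0")
  case True
  then show ?thesis by (auto simp: admissible_factors_def)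
next
  case False
  obtain D where "\<And>n. n \<ge> 1 \<Longrightarrow> \<bar>omega a T \<theta> \<alpha> (\<lambda>_. 1) z n - \<kappa> / (\<alpha> - 1) * real n powr (1 - \<alpha>)\<bar>
            \<le> D * real n powr (- \<alpha>)" using omega_asymp[OF \<alpha>] by blast
  moreover have "\<kappa> / (\<alpha> - 1) \<noteq> 0" using C \<alpha> T_pos by (simp add: \<kappa>_def)
  ultimately have "\<forall>\<^sub>F n in sequentially. omega a T \<theta> \<alpha> (\<lambda>_. 1) z n \<noteq> 0"
    by (intro inverse_tail_asymp(1)[where A = "\<kappa> / (\<alpha> - 1)" and L = 1 and \<alpha> = \<alpha> and D = D]) auto
  then obtain N where N: "\<And>n. n \<ge> N \<Longrightarrow> omega a T \<theta> \<alpha> (\<lambda>_. 1) z n \<noteq> 0"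
    by (auto simp: eventually_sequentially)
  define c :: "nat \<Rightarrow> real" where "c m = (if m \<ge> Suc N then 1 else 0)" for m
  have c1: "c m = 1" if "m \<ge> Suc N" for m using that by (simp add: c_def)
  have ge: "omega a T \<theta> \<alpha> c z n \<noteq> 0" if "n \<ge> N" for n
    using omega_eventually_unmodified[of "Suc N" c n \<alpha>, OF c1] N[of n] that by simp
  \<comment> \<open>Descending induction from \<open>N\<close>: below \<open>N\<close> the term
    separating consecutive values has factor 0.\<close>
  have "omega a T \<theta> \<alpha> c z n \<noteq> 0" if "n \<le> N" for n
    using that
  proof (induction n rule: inc_induct)
    case base
    show ?case by (rule ge) simp
  next
    case (step n)
    then have "c (Suc n) = 0" by (simp add: c_def)
    then show ?case using omega_step[of \<alpha> "Suc N" c n, OF \<alpha> c1] step.IH by simp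
  qed
  with ge have "omega a T \<theta> \<alpha> c z n \<noteq> 0" for n by (cases "n \<le> N") auto
  then have "admissible_factors a T \<theta> \<alpha> z c"
    unfolding admissible_factors_def using False N c1
    by (auto intro!: exI[of _ "Suc N"])
  then show ?thesis by blast
qed

lemma u_seq_recurrence:
  assumes \<alpha>: "\<alpha> > 1" and c: "admissible_factors a T \<theta> \<alpha> z c" and n: "n \<ge> 2"
  shows "of_real (a (n - 1) * u_seq a T \<theta> \<alpha> c z (n - 1)) + of_real (a n * u_seq a T \<theta> \<alpha> c z (n + 1))
      + (of_real (q_seq a T \<theta> \<alpha> c z n) - z) * of_real (u_seq a T \<theta> \<alpha> c z n) = 0"
proof -
  define x where "x = Re z"
  obtain k where k: "n = Suc k" using n by (cases n) auto
  obtain L where c1: "\<And>m. m \<ge> L \<Longrightarrow> c m = 1" and nz: "\<And>n. n \<ge> 1 \<Longrightarrow> omega a T \<theta> \<alpha> c z n \<noteq> 0"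
    using admissible_factorsD[OF c] by blast
  let ?w = "omega a T \<theta> \<alpha> c z"
  define p where "p = c n * real n powr (- \<alpha>)"
  define r where "r = c (n + 1) * real (n + 1) powr (- \<alpha>)"
  have w1: "?w (n - 1) = p * y n * y (n - 1) + ?w n"
    using omega_step[of \<alpha> L c k, OF \<alpha> c1] by (simp add: p_def k)
  have w2: "?w (n + 1) = ?w n - r * y (n + 1) * y n"
    using omega_step[of \<alpha> L c n, OF \<alpha> c1] by (simp add: r_def)
  have yr: "a (n - 1) * y (n - 1) + a n * y (n + 1) = x * y n"
    using y_rec[of k] by (simp add: x_def k)
  have q: "q_seq a T \<theta> \<alpha> c z n * ?w n = - a (n - 1) * (y (n - 1))\<^sup>2 * p + a n * (y (n + 1))\<^sup>2 * r"
    using nz[of n] n unfolding q_seq_def p_def r_def by (simp add: field_simps)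
  \<comment> \<open>Expressing both neighbours through \<open>?w n\<close> separates a multiple of
    the unperturbed recurrence from a remainder divisible by \<open>y n\<close>, which
    \<open>q_seq\<close> is built to cancel.\<close>
  have "a (n - 1) * (?w (n - 1) * y (n - 1)) + a n * (?w (n + 1) * y (n + 1))
      + (q_seq a T \<theta> \<alpha> c z n - x) * (?w n * y n)
      = ?w n * (a (n - 1) * y (n - 1) + a n * y (n + 1) - x * y n)
      + y n * (a (n - 1) * (y (n - 1))\<^sup>2 * p - a n * (y (n + 1))\<^sup>2 * r + q_seq a T \<theta> \<alpha> c z n * ?w n)"
    unfolding w1 w2 by (simp add: algebra_simps power2_eq_square)
  also have "\<dots> = 0" unfolding yr q by simp
  finally have "a (n - 1) * u_seq a T \<theta> \<alpha> c z (n - 1) + a n * u_seq a T \<theta> \<alpha> c z (n + 1)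
      + (q_seq a T \<theta> \<alpha> c z n - x) * u_seq a T \<theta> \<alpha> c z n = 0"
    unfolding u_seq_def .
  then show ?thesis by (simp add: complex_eq_iff Im_z x_def)
qed

subsection \<open>Asymptotics of the potential\<close>

text \<open>Both quotients in \<open>q_seq\<close> are \<open>1 / (A * real n)\<close> up to
  \<open>O(1 / n^2)\<close>, and their coefficients are bounded.\<close>

lemma q_seq_leading_term:
  assumes \<alpha>: "\<alpha> > 1" and C: "C_const a T \<theta> z \<noteq> 0" and c: "admissible_factors a T \<theta> \<alpha> z c"
  shows "(\<lambda>n. q_seq a T \<theta> \<alpha> c z n - (- a (n - 1) * (y (n - 1))\<^sup>2 + a n * (y (n + 1))\<^sup>2)
            * (1 / (\<kappa> / (\<alpha> - 1) * real n))) \<in> O(\<lambda>n. 1 / (real n)\<^sup>2)"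
proof -
  define A where "A = \<kappa> / (\<alpha> - 1)"
  have A: "A \<noteq> 0" using C \<alpha> T_pos by (simp add: A_def \<kappa>_def)
  let ?w = "omega a T \<theta> \<alpha> c z"
  obtain L where c1: "\<And>m. m \<ge> L \<Longrightarrow> c m = 1" using admissible_factorsD[OF c] by blast
  obtain D where "\<And>n. n \<ge> 1 \<Longrightarrow> \<bar>omega a T \<theta> \<alpha> (\<lambda>_. 1) z n - A * real n powr (1 - \<alpha>)\<bar>
            \<le> D * real n powr (- \<alpha>)" using omega_asymp[OF \<alpha>] unfolding A_def by blast
  then have D: "\<bar>?w n - A * real n powr (1 - \<alpha>)\<bar> \<le> D * real n powr (- \<alpha>)" if "n \<ge> Suc L" for n
    using omega_eventually_unmodified[of L c n \<alpha>, OF c1] that by simp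
  obtain K where K: "\<And>n. \<bar>y n\<bar> \<le> K" using y_bounded by blast
  have a_bdd: "\<bar>a n\<bar> \<le> (\<Sum>i<T. a i)" for n
  proof -
    have "a n = a (n mod T)" using a_per_power[of "n mod T" "n div T"] by (simp add: add.commute)
    also have "\<dots> \<le> (\<Sum>i<T. a i)"
      using T_pos a_pos by (intro member_le_sum) (auto intro: less_imp_le)
    finally show ?thesis using a_pos[of n] by simp
  qed
  \<comment> \<open>Free index maps cover both coefficients, at \<open>n\<close>,
    \<open>n + 1\<close> and at \<open>n - 1\<close>, \<open>n - 1\<close>.\<close>
  have ay: "(\<lambda>n. a (f n) * (y (g n))\<^sup>2) \<in> O(\<lambda>_. 1)" for f g :: "nat \<Rightarrow> nat"
  proof (rule bigoI)
    show "\<forall>\<^sub>F n in sequentially. norm (a (f n) * (y (g n))\<^sup>2) \<le> (\<Sum>i<T. a i) * K\<^sup>2 * norm (1::real)"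
    proof (intro always_eventually allI)
      fix n
      have "(y (g n))\<^sup>2 \<le> K\<^sup>2" using K[of "g n"] by (rule abs_le_square_iff[THEN iffD1, OF order_trans]) simp
      then show "norm (a (f n) * (y (g n))\<^sup>2) \<le> (\<Sum>i<T. a i) * K\<^sup>2 * norm (1::real)"
        using a_bdd[of "f n"] a_pos unfolding real_norm_def abs_mult
        by (simp, intro mult_mono) (auto intro: sum_nonneg less_imp_le)
    qed
  qed
  have "(\<lambda>n. a n * (y (n + 1))\<^sup>2 * (real (n + 1) powr (- \<alpha>) / ?w n - 1 / (A * real n))
        - a (n - 1) * (y (n - 1))\<^sup>2 * (real n powr (- \<alpha>) / ?w n - 1 / (A * real n)))
        \<in> O(\<lambda>n. 1 / (real n)\<^sup>2)"
    using landau_o.big.mult[OF ay inverse_tail_asymp(3)[OF A D]]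
      landau_o.big.mult[OF ay inverse_tail_asymp(2)[OF A D]]
    by (intro sum_in_bigo) simp_all
  then show ?thesis
  proof (rule landau_o.big.in_cong[THEN iffD1, rotated])
    show "\<forall>\<^sub>F n in sequentially.
      a n * (y (n + 1))\<^sup>2 * (real (n + 1) powr (- \<alpha>) / ?w n - 1 / (A * real n))
        - a (n - 1) * (y (n - 1))\<^sup>2 * (real n powr (- \<alpha>) / ?w n - 1 / (A * real n))
      = q_seq a T \<theta> \<alpha> c z n - (- a (n - 1) * (y (n - 1))\<^sup>2 + a n * (y (n + 1))\<^sup>2)
            * (1 / (\<kappa> / (\<alpha> - 1) * real n))"
      using eventually_ge_at_top[of L]
    proof eventually_elim
      case (elim n)
      then have "c n = 1" "c (n + 1) = 1" by (simp_all add: c1)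
      then show ?case unfolding q_seq_def A_def[symmetric] by (simp add: algebra_simps)
    qed
  qed
qed

text \<open>Polar form of \<open>K\<close>; the phase \<open>pi / 2\<close> converts the resulting
  cosine into a sine.\<close>

lemma Re_cis_mult_sin:
  "Re (cis x * K) = cmod K * sin (x + (Arg K + pi / 2))"
proof -
  have "cis x * K = rcis (cmod K) (x + Arg K)"
    using rcis_cmod_Arg[of K] by (metis cis_rcis_eq mult_1 rcis_mult)
  then show ?thesis using sin_add[of "x + Arg K" "pi / 2"] by (simp add: add.assoc)
qed

text \<open>By \<open>(Im v)^2 = (cmod v^2 - Re (v^2)) / 2\<close> the moduli, constant on each
  residue class, give \<delta>, while the squares rotate by twice the quasi-momentum per
  period.\<close>

lemma leading_term_sinusoidal:
  "\<exists>\<rho> \<zeta> \<delta> :: nat \<Rightarrow> real. \<forall>n\<ge>T.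
     - a (n - 1) * (y (n - 1))\<^sup>2 + a n * (y (n + 1))\<^sup>2
       = \<rho> (n mod T) * sin (2 * real n * \<theta> z / real T + \<zeta> (n mod T)) + \<delta> (n mod T)"
proof -
  \<comment> \<open>The index \<open>s + T - 1\<close> replaces \<open>s - 1\<close>, which would be
    truncated at \<open>s = 0\<close>. In \<open>K\<close> the factor
    \<open>cis (- \<theta> z)\<close> undoes this shift by a period, and the leading factor corrects
    the phase from \<open>n\<close> to \<open>n - s\<close>.\<close>
  define \<delta> where "\<delta> s = (a s * (cmod (\<phi> (s + 1)))\<^sup>2 - a (s + T - 1) * (cmod (\<phi> (s + T - 1)))\<^sup>2) / 2" for s
  define K where "K s = cis (- 2 * real s * \<theta> z / real T) *
     (of_real (a (s + T - 1)) * (cis (- \<theta> z) * \<phi> (s + T - 1))\<^sup>2 - of_real (a s) * (\<phi> (s + 1))\<^sup>2) / 2" for s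
  have Im2: "(Im v)\<^sup>2 = ((cmod v)\<^sup>2 - Re (v\<^sup>2)) / 2" for v
    by (simp add: cmod_def power2_eq_square)
  have "- a (n - 1) * (y (n - 1))\<^sup>2 + a n * (y (n + 1))\<^sup>2
       = cmod (K (n mod T)) * sin (2 * real n * \<theta> z / real T + (Arg (K (n mod T)) + pi / 2)) + \<delta> (n mod T)"
    if "n \<ge> T" for n
  proof -
    define s where "s = n mod T"
    define k where "k = n div T"
    have n: "n = s + k * T" by (simp add: s_def k_def)
    \<comment> \<open>With a full period available, \<open>n - 1\<close> can be written as
      \<open>s + T - 1\<close> plus \<open>k - 1\<close> periods.\<close>
    have k1: "k \<ge> 1" using that T_pos by (simp add: k_def div_greater_zero_iff Suc_le_eq)
    then obtain k' where k': "k = Suc k'" by (cases k) auto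
    have n1: "n - 1 = (s + T - 1) + k' * T" using T_pos unfolding n k' by simp
    have a1: "a (n - 1) = a (s + T - 1)" unfolding n1 by (rule a_per_power)
    have a2: "a n = a s" unfolding n by (rule a_per_power)
    have p2: "\<phi> (n + 1) = cis (real k * \<theta> z) * \<phi> (s + 1)"
      using bloch_shift_power[of "s + 1" k] unfolding n by (simp add: add_ac)
    have "\<phi> (n - 1) = cis (real k' * \<theta> z) * \<phi> (s + T - 1)"
      unfolding n1 by (rule bloch_shift_power)
    also have "cis (real k' * \<theta> z) = cis (real k * \<theta> z) * cis (- \<theta> z)"
      by (simp add: cis_mult k' algebra_simps)
    finally have p1: "\<phi> (n - 1) = cis (real k * \<theta> z) * (cis (- \<theta> z) * \<phi> (s + T - 1))"
      by (simp add: mult.assoc)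
    have "2 * real n * \<theta> z / real T + - 2 * real s * \<theta> z / real T = 2 * (real k * \<theta> z)"
      using T_pos unfolding n by (simp add: field_simps)
    then have "cis (2 * real n * \<theta> z / real T) * K s = (cis (real k * \<theta> z))\<^sup>2 *
       (of_real (a (s + T - 1)) * (cis (- \<theta> z) * \<phi> (s + T - 1))\<^sup>2 - of_real (a s) * (\<phi> (s + 1))\<^sup>2) / 2"
      unfolding K_def by (simp add: cis_mult power2_eq_square mult.assoc[symmetric])
    also have "\<dots> = (of_real (a (n - 1)) * (\<phi> (n - 1))\<^sup>2 - of_real (a n) * (\<phi> (n + 1))\<^sup>2) / 2"
      unfolding p1 p2 a1 a2 by (simp add: algebra_simps power_mult_distrib)
    finally have "Re (cis (2 * real n * \<theta> z / real T) * K s) =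
        Re ((of_real (a (n - 1)) * (\<phi> (n - 1))\<^sup>2 - of_real (a n) * (\<phi> (n + 1))\<^sup>2) / 2)"
      by (rule arg_cong)
    also have "\<dots> = (a (n - 1) * Re ((\<phi> (n - 1))\<^sup>2) - a n * Re ((\<phi> (n + 1))\<^sup>2)) / 2"
      by simp
    finally have re: "Re (cis (2 * real n * \<theta> z / real T) * K s) =
        (a (n - 1) * Re ((\<phi> (n - 1))\<^sup>2) - a n * Re ((\<phi> (n + 1))\<^sup>2)) / 2" .
    have cm: "cmod (\<phi> (n - 1)) = cmod (\<phi> (s + T - 1))" "cmod (\<phi> (n + 1)) = cmod (\<phi> (s + 1))"
      unfolding p1 p2 by (simp_all add: norm_mult)
    show ?thesis
      unfolding Im2 Re_cis_mult_sin[symmetric] s_def[symmetric] \<delta>_def re cm a1 a2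
      by (simp add: field_simps)
  qed
  then show ?thesis
    by (rule_tac x = "\<lambda>s. cmod (K s)" in exI, rule_tac x = "\<lambda>s. Arg (K s) + pi / 2" in exI,
        rule_tac x = \<delta> in exI) simp
qed

text \<open>The leading term does not involve \<open>c\<close>, so one choice of coefficients serves
  all admissible factors. The constant \<open>A\<close> is absorbed into \<rho> and
  \<delta>.\<close>

lemma q_seq_asymp:
  assumes \<alpha>: "\<alpha> > 1" and C: "C_const a T \<theta> z \<noteq> 0"
  shows "\<exists>\<rho> \<zeta> \<delta> :: nat \<Rightarrow> real. \<forall>c. admissible_factors a T \<theta> \<alpha> z c \<longrightarrow>
     (\<lambda>n. q_seq a T \<theta> \<alpha> c z n - 1 / real n *
        (\<rho> (n mod T) * sin (2 * real n * \<theta> z / real T + \<zeta> (n mod T)) + \<delta> (n mod T)))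
     \<in> O(\<lambda>n. 1 / (real n)\<^sup>2)"
proof -
  define A where "A = \<kappa> / (\<alpha> - 1)"
  obtain \<rho> \<zeta> \<delta> :: "nat \<Rightarrow> real" where E: "\<And>n. n \<ge> T \<Longrightarrow>
     - a (n - 1) * (y (n - 1))\<^sup>2 + a n * (y (n + 1))\<^sup>2
       = \<rho> (n mod T) * sin (2 * real n * \<theta> z / real T + \<zeta> (n mod T)) + \<delta> (n mod T)"
    using leading_term_sinusoidal by blast
  have "(\<lambda>n. q_seq a T \<theta> \<alpha> c z n - 1 / real n *
        (\<rho> (n mod T) / A * sin (2 * real n * \<theta> z / real T + \<zeta> (n mod T)) + \<delta> (n mod T) / A))
     \<in> O(\<lambda>n. 1 / (real n)\<^sup>2)" if c: "admissible_factors a T \<theta> \<alpha> z c" for c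
  proof (rule landau_o.big.in_cong[THEN iffD1, OF _ q_seq_leading_term[OF \<alpha> C c]])
    show "\<forall>\<^sub>F n in sequentially.
       q_seq a T \<theta> \<alpha> c z n - (- a (n - 1) * (y (n - 1))\<^sup>2 + a n * (y (n + 1))\<^sup>2)
            * (1 / (\<kappa> / (\<alpha> - 1) * real n))
       = q_seq a T \<theta> \<alpha> c z n - 1 / real n *
        (\<rho> (n mod T) / A * sin (2 * real n * \<theta> z / real T + \<zeta> (n mod T)) + \<delta> (n mod T) / A)"
      using eventually_ge_at_top[of T]
    proof eventually_elim
      case (elim n)
      show ?case
        unfolding E[OF elim] A_def[symmetric] by (simp add: add_divide_distrib distrib_left mult_ac)
    qed
  qed
  then show ?thesis
    by (intro exI[of _ "\<lambda>s. \<rho> s / A"] exI[of _ \<zeta>] exI[of _ "\<lambda>s. \<delta> s / A"]) blast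
qed

end

section \<open>Assembly over all elliptic points\<close>

theorem theorem6p1:
  fixes a :: "nat \<Rightarrow> real" and T :: nat and \<theta> :: "complex \<Rightarrow> real" and \<alpha> :: real
  assumes "T \<ge> 1"
    and "\<And>j. 1 \<le> j \<Longrightarrow> j \<le> T \<Longrightarrow> a j > 0"
    and "\<And>n. a (n + T) = a n"
    and "quasi_momentum a T \<theta>"
    and "\<alpha> > 3 / 2"
  shows "(\<forall>z\<in>elliptic_points a T. C_const a T \<theta> z \<noteq> 0 \<longrightarrow>
            (\<exists>c. admissible_factors a T \<theta> \<alpha> z c) \<and>
            (\<forall>c. admissible_factors a T \<theta> \<alpha> z c \<longrightarrow>
              (\<forall>n\<ge>2. of_real (a (n - 1) * u_seq a T \<theta> \<alpha> c z (n - 1))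
                      + of_real (a n * u_seq a T \<theta> \<alpha> c z (n + 1))
                      + (of_real (q_seq a T \<theta> \<alpha> c z n) - z) * of_real (u_seq a T \<theta> \<alpha> c z n) = 0)))
       \<and> (\<exists>\<rho> \<zeta> \<delta> :: nat \<Rightarrow> complex \<Rightarrow> real.
            \<forall>z\<in>elliptic_points a T. C_const a T \<theta> z \<noteq> 0 \<longrightarrow>
              (\<forall>c. admissible_factors a T \<theta> \<alpha> z c \<longrightarrow>
                (\<lambda>n. q_seq a T \<theta> \<alpha> c z n
                   - 1 / real n * (\<rho> (n mod T) z * sin (2 * real n * \<theta> z / real T + \<zeta> (n mod T) z)
                                   + \<delta> (n mod T) z))
                \<in> O(\<lambda>n. 1 / (real n)\<^sup>2)))"
proof -
  have loc: "elliptic_point a T \<theta> z" if "z \<in> elliptic_points a T" for z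
    using assms that by unfold_locales auto
  have \<alpha>: "\<alpha> > 1" using assms(5) by simp
  \<comment> \<open>Packages the expansion at one point so that the coefficients can be chosen as
    functions of \<open>z\<close>.\<close>
  define P where "P z \<rho> \<zeta> \<delta> \<longleftrightarrow> (\<forall>c. admissible_factors a T \<theta> \<alpha> z c \<longrightarrow>
     (\<lambda>n. q_seq a T \<theta> \<alpha> c z n - 1 / real n *
        (\<rho> (n mod T) * sin (2 * real n * \<theta> z / real T + \<zeta> (n mod T)) + \<delta> (n mod T)))
     \<in> O(\<lambda>n. 1 / (real n)\<^sup>2))" for z and \<rho> \<zeta> \<delta> :: "nat \<Rightarrow> real"
  have "\<exists>\<rho> \<zeta> \<delta>. P z \<rho> \<zeta> \<delta>" if "z \<in> elliptic_points a T" "C_const a T \<theta> z \<noteq> 0" for z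
    unfolding P_def using elliptic_point.q_seq_asymp[OF loc[OF that(1)] \<alpha> that(2)] .
  then obtain \<rho> \<zeta> \<delta> :: "complex \<Rightarrow> nat \<Rightarrow> real" where
    asymp: "\<And>z. z \<in> elliptic_points a T \<Longrightarrow> C_const a T \<theta> z \<noteq> 0 \<Longrightarrow> P z (\<rho> z) (\<zeta> z) (\<delta> z)"
    by metis
  show ?thesis
  proof (rule conjI)
    show "\<exists>\<rho> \<zeta> \<delta> :: nat \<Rightarrow> complex \<Rightarrow> real.
        \<forall>z\<in>elliptic_points a T. C_const a T \<theta> z \<noteq> 0 \<longrightarrow>
          (\<forall>c. admissible_factors a T \<theta> \<alpha> z c \<longrightarrow>
            (\<lambda>n. q_seq a T \<theta> \<alpha> c z n
               - 1 / real n * (\<rho> (n mod T) z * sin (2 * real n * \<theta> z / real T + \<zeta> (n mod T) z)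
                               + \<delta> (n mod T) z))
            \<in> O(\<lambda>n. 1 / (real n)\<^sup>2))"
      using asymp unfolding P_def
      by (rule_tac x = "\<lambda>s z. \<rho> z s" in exI, rule_tac x = "\<lambda>s z. \<zeta> z s" in exI,
          rule_tac x = "\<lambda>s z. \<delta> z s" in exI) blast
  qed (use elliptic_point.admissible_factors_exist[OF loc \<alpha>] elliptic_point.u_seq_recurrence[OF loc \<alpha>]
      in blast)
qed

end
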